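(* One has $\mathbb H_\mu\setminus\mathbb H_N=\mathrm{int}(\mathbb H_\mu)\setminus\mathbb H_N$, and this set contains a non-empty open set in $\mathbb C^4$.
   Context: $\mathrm{int}(\cdot)$ denotes the interior in $\mathbb C^4$; $\|\cdot\|$ is the operator norm on $M_2(\mathbb C)$ induced by the Euclidean norm on $\mathbb C^2$. Let $E\subset M_2(\mathbb C)$ be the linear space of all upper triangular matrices. For $A\in M_2(\mathbb C)$, $$\mu_{\mathrm{hexa}}(A)=\frac{1}{\inf\{\|X\| : X\in E,\ \det(I-AX)=0\}},$$ with $\mu_{\mathrm{hexa}}(A)=0$ if $\det(I-AX)\ne0$ for all $X\in E$. $\pi:M_2(\mathbb C)\to\mathbb C^4$ is $\pi((a_{ij}))=(a_{21},a_{11},a_{22},\det(A))$. The $\mu$-hexablock is $\mathbb H_\mu=\{\pi(A): A\in M_2(\mathbb C),\ \mu_{\mathrm{hexa}}(A)<1\}$ and the normed hexablock is $\mathbb H_N=\{\pi(A): A\in M_2(\mathbb C),\ \|A\|<1\}$. *)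

theory Defs
  imports "HOL-Analysis.Analysis"
begin

text \<open>For a matrix \<open>A :: complex^2^2\<close>, the entry \<open>A $ i $ j\<close> is in row \<open>i\<close> and column \<open>j\<close>.\<close>

text \<open>The norm on \<^typ>\<open>complex^2\<close> is the Euclidean (Hermitian) one.\<close>

definition mat_opnorm :: "complex^2^2 \<Rightarrow> real" where
  "mat_opnorm A = onorm (\<lambda>v. A *v v)"

text \<open>The indices are spelled out because in the numeral type \<open>2\<close> the index \<open>2\<close> equals \<open>0\<close>
  and hence precedes \<open>1\<close> in the library order.\<close>

definition upper_triangular2 :: "(complex^2^2) set" where
  "upper_triangular2 = {X. X $ 2 $ 1 = 0}"

definition mu_hexa :: "complex^2^2 \<Rightarrow> real" where
  "mu_hexa A =
    (if \<forall>X\<in>upper_triangular2. det (mat 1 - A ** X) \<noteq> 0 then 0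
     else 1 / Inf {mat_opnorm X | X. X \<in> upper_triangular2 \<and> det (mat 1 - A ** X) = 0})"

definition hexa_proj :: "complex^2^2 \<Rightarrow> complex^4" where
  "hexa_proj A = vector [A $ 2 $ 1, A $ 1 $ 1, A $ 2 $ 2, det A]"

definition mu_hexablock :: "(complex^4) set" where
  "mu_hexablock = {hexa_proj A | A. mu_hexa A < 1}"

definition normed_hexablock :: "(complex^4) set" where
  "normed_hexablock = {hexa_proj A | A. mat_opnorm A < 1}"

end

theory Submission
  imports Defs
begin

text \<open>
  For \<open>X\<close> upper triangular, \<open>det (I - A X)\<close> depends on \<open>A\<close> only through \<open>q = \<pi>(A)\<close>, and it is a
  polynomial in \<open>q\<close> and the entries of \<open>X\<close> (lemma \<open>det_pencil_upper_triangular\<close>). Since the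
  infimum in the definition of \<open>\<mu>\<close> is attained, \<open>\<mu>(A) < 1\<close> means that this polynomial has no zero
  in the compact set \<open>K\<close> of upper triangular contractions (lemma \<open>mu_hexa_less_1_iff\<close>), and by
  compactness of \<open>K\<close> this is an open condition on \<open>q\<close>.

  The \<open>\<mu>\<close>-hexablock fails to be open only because \<open>\<pi>\<close> is not surjective: a point \<open>q\<close> with
  \<open>q\<^sub>1 \<noteq> 0\<close> is always of the form \<open>\<pi>(A)\<close>, as the entry \<open>a\<^sub>1\<^sub>2\<close> can be solved from the determinant,
  while \<open>q\<^sub>1 = 0\<close> forces \<open>q\<^sub>4 = q\<^sub>2 q\<^sub>3\<close>. So the part with \<open>q\<^sub>1 \<noteq> 0\<close> is open. In the remaining part
  \<open>A\<close> is triangular, \<open>\<mu>(A) < 1\<close> bounds both diagonal entries by \<open>1\<close>, and the diagonal matrix with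
  these entries shows that \<open>\<pi>(A)\<close> lies in the normed hexablock. Removing the normed hexablock
  therefore leaves only interior points.

  For the open subset, remove from the part \<open>q\<^sub>1 \<noteq> 0\<close> the compact set of all \<open>\<pi>(A)\<close> with
  \<open>\<parallel>A\<parallel> \<le> 1\<close>. The result is open, and it contains \<open>\<pi>(A)\<close> for the matrix \<open>A\<close> with \<open>a\<^sub>1\<^sub>2 = 2\<close>,
  \<open>a\<^sub>2\<^sub>1 = 1/4\<close> and zero diagonal: its norm is at least \<open>2\<close>, it is the only matrix over \<open>\<pi>(A)\<close>, and
  its small entry \<open>a\<^sub>2\<^sub>1\<close> keeps both the first and the last coordinate of \<open>\<pi>(A)\<close> small.
\<close>

section \<open>The operator norm\<close>

lemma norm_mult_le_opnorm: "norm (A *v v) \<le> mat_opnorm A * norm v"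
  unfolding mat_opnorm_def by (rule onorm) simp

lemma norm_entry_le_opnorm: "norm (A $ i $ j) \<le> mat_opnorm A"
proof -
  have "norm (A $ i $ j) = norm ((A *v axis j 1) $ i)"
    by (simp add: matrix_vector_mult_def axis_def if_distrib cong: if_cong)
  also have "\<dots> \<le> norm (A *v axis j 1)"
    by (rule Finite_Cartesian_Product.norm_nth_le)
  also have "\<dots> \<le> mat_opnorm A"
    using norm_mult_le_opnorm[of A "axis j 1"] by simp
  finally show ?thesis .
qed

lemma continuous_on_opnorm: "continuous_on S mat_opnorm"
proof -
  have "convex_on UNIV mat_opnorm"
  proof (rule convex_onI)
    fix t :: real and A B :: "complex^2^2"
    assume t: "0 < t" "t < 1"
    have lin: "(\<lambda>v. ((1 - t) *\<^sub>R A + t *\<^sub>R B) *v v)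
        = (\<lambda>v. (1 - t) *\<^sub>R (A *v v) + t *\<^sub>R (B *v v))"
      by (rule ext)
        (simp add: vec_eq_iff matrix_vector_mult_def scaleR_sum_right ring_distribs sum.distrib)
    have "mat_opnorm ((1 - t) *\<^sub>R A + t *\<^sub>R B)
        = onorm (\<lambda>v. (1 - t) *\<^sub>R (A *v v) + t *\<^sub>R (B *v v))"
      unfolding mat_opnorm_def by (simp only: lin)
    also have "\<dots> \<le> onorm (\<lambda>v. (1 - t) *\<^sub>R (A *v v)) + onorm (\<lambda>v. t *\<^sub>R (B *v v))"
      by (intro onorm_triangle bounded_linear_scaleR_const matrix_vector_mul_bounded_linear
          bounded_linear_const_scaleR)
    also have "\<dots> = (1 - t) * mat_opnorm A + t * mat_opnorm B"
      using t by (simp add: onorm_scaleR mat_opnorm_def)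
    finally show "mat_opnorm ((1 - t) *\<^sub>R A + t *\<^sub>R B) \<le> (1 - t) * mat_opnorm A + t * mat_opnorm B" .
  qed simp
  then show ?thesis
    using convex_on_continuous[OF open_UNIV] continuous_on_subset by blast
qed

lemma compact_opnorm_ball: "compact {A. mat_opnorm A \<le> r}"
proof -
  have "norm A \<le> (\<Sum>i\<in>(UNIV :: 2 set). \<Sum>j\<in>(UNIV :: 2 set). r)" if "mat_opnorm A \<le> r" for A
  proof -
    have "norm A \<le> (\<Sum>i\<in>UNIV. norm (A $ i))"
      unfolding norm_vec_def by (rule L2_set_le_sum) simp
    also have "\<dots> \<le> (\<Sum>i\<in>UNIV. \<Sum>j\<in>UNIV. norm (A $ i $ j))"
      by (intro sum_mono, subst norm_vec_def, rule L2_set_le_sum) simp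
    also have "\<dots> \<le> (\<Sum>i\<in>(UNIV :: 2 set). \<Sum>j\<in>(UNIV :: 2 set). r)"
      by (intro sum_mono order_trans[OF norm_entry_le_opnorm that])
    finally show ?thesis .
  qed
  then have "bounded {A. mat_opnorm A \<le> r}"
    unfolding bounded_iff by blast
  moreover have "closed {A. mat_opnorm A \<le> r}"
    by (intro closed_Collect_le continuous_on_opnorm continuous_on_const)
  ultimately show ?thesis
    by (simp add: compact_eq_bounded_closed)
qed

lemma opnorm_diagonal_le:
  assumes "A $ 1 $ 2 = 0" "A $ 2 $ 1 = 0" "norm (A $ 1 $ 1) \<le> c" "norm (A $ 2 $ 2) \<le> c"
  shows "mat_opnorm A \<le> c"
  unfolding mat_opnorm_def
proof (rule onorm_le)
  fix v :: "complex^2"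
  have c: "0 \<le> c"
    using assms(3) norm_ge_zero order_trans by blast
  have "L2_set (\<lambda>i. norm ((A *v v) $ i)) UNIV \<le> L2_set (\<lambda>i. c * norm (v $ i)) (UNIV :: 2 set)"
  proof (rule L2_set_mono)
    fix i :: 2
    show "norm ((A *v v) $ i) \<le> c * norm (v $ i)"
      using assms exhaust_2[of i]
      by (auto simp: matrix_vector_mult_def sum_2 norm_mult intro!: mult_right_mono)
  qed simp
  then show "norm (A *v v) \<le> c * norm v"
    using c by (simp add: norm_vec_def L2_set_right_distrib)
qed

section \<open>The determinant on upper triangular matrices\<close>

definition upper_contractions :: "(complex^2^2) set" where
  "upper_contractions = {X \<in> upper_triangular2. mat_opnorm X \<le> 1}"

definition hexa_poly :: "complex^4 \<Rightarrow> complex^2^2 \<Rightarrow> complex" where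
  "hexa_poly q X = 1 - q $ 2 * X $ 1 $ 1 - q $ 1 * X $ 1 $ 2 - q $ 3 * X $ 2 $ 2
     + q $ 4 * X $ 1 $ 1 * X $ 2 $ 2"

lemma vector_4_nth:
  fixes x y z w :: "'a::zero"
  shows "(vector [x, y, z, w] :: 'a^4) $ 1 = x" "(vector [x, y, z, w] :: 'a^4) $ 2 = y"
    "(vector [x, y, z, w] :: 'a^4) $ 3 = z" "(vector [x, y, z, w] :: 'a^4) $ 4 = w"
  by (simp_all add: vector_def)

lemma hexa_proj_nth:
  "hexa_proj A $ 1 = A $ 2 $ 1" "hexa_proj A $ 2 = A $ 1 $ 1"
  "hexa_proj A $ 3 = A $ 2 $ 2" "hexa_proj A $ 4 = det A"
  by (simp_all add: hexa_proj_def vector_4_nth)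

text \<open>This is \<open>det (I - M) = 1 - tr M + det M\<close> for \<open>M = A X\<close>. In the trace the entry \<open>A $ 1 $ 2\<close> meets
  only the vanishing entry \<open>X $ 2 $ 1\<close>, so it enters the determinant only through \<open>det A\<close>.\<close>

lemma det_pencil_upper_triangular:
  assumes "X \<in> upper_triangular2"
  shows "det (mat 1 - A ** X) = hexa_poly (hexa_proj A) X"
  using assms
  by (simp add: upper_triangular2_def hexa_poly_def hexa_proj_nth det_2 mat_def
      matrix_matrix_mult_def sum_2 algebra_simps)

lemma closed_upper_triangular: "closed upper_triangular2"
  unfolding upper_triangular2_def by (intro closed_Collect_eq continuous_intros)

lemma compact_upper_contractions: "compact upper_contractions"
proof -
  have "upper_contractions = upper_triangular2 \<inter> {X. mat_opnorm X \<le> 1}"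
    by (auto simp: upper_contractions_def)
  then show ?thesis
    using closed_Int_compact[OF closed_upper_triangular compact_opnorm_ball[of 1]] by simp
qed

text \<open>The \<open>X\<close> with \<open>det (I - A X) = 0\<close> form a closed set on which the norm has compact sublevel
  sets, so if there are any, the infimum defining \<open>mu_hexa\<close> is a minimum. It is positive, because
  \<open>X = 0\<close> gives determinant \<open>1\<close>; the value \<open>1 / 0 = 0\<close> thus never occurs.\<close>

lemma mu_hexa_less_1_iff:
  "mu_hexa A < 1 \<longleftrightarrow> (\<forall>X\<in>upper_contractions. hexa_poly (hexa_proj A) X \<noteq> 0)"
proof (cases "\<exists>X\<in>upper_triangular2. det (mat 1 - A ** X) = 0")
  case False
  then have "mu_hexa A = 0"
    by (simp add: mu_hexa_def)
  with False show ?thesis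
    by (auto simp: upper_contractions_def det_pencil_upper_triangular[symmetric])
next
  case True
  define Z where "Z = {X \<in> upper_triangular2. hexa_poly (hexa_proj A) X = 0}"
  have Z_eq: "{mat_opnorm X | X. X \<in> upper_triangular2 \<and> det (mat 1 - A ** X) = 0}
      = mat_opnorm ` Z"
    by (auto simp: Z_def det_pencil_upper_triangular)
  obtain X0 where X0: "X0 \<in> Z"
    using True by (auto simp: Z_def det_pencil_upper_triangular)
  have "Z = upper_triangular2 \<inter> {X. hexa_poly (hexa_proj A) X = 0}"
    by (auto simp: Z_def)
  moreover have "closed {X. hexa_poly (hexa_proj A) X = 0}"
    unfolding hexa_poly_def by (intro closed_Collect_eq continuous_intros)
  ultimately have "closed Z"
    using closed_upper_triangular by auto
  then have "compact (Z \<inter> {X. mat_opnorm X \<le> mat_opnorm X0})"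
    by (rule closed_Int_compact[OF _ compact_opnorm_ball])
  then obtain X1 where X1: "X1 \<in> Z" "mat_opnorm X1 \<le> mat_opnorm X0"
    and "\<And>Y. Y \<in> Z \<Longrightarrow> mat_opnorm Y \<le> mat_opnorm X0 \<Longrightarrow> mat_opnorm X1 \<le> mat_opnorm Y"
    using continuous_attains_inf[of "Z \<inter> {X. mat_opnorm X \<le> mat_opnorm X0}" mat_opnorm]
      X0 continuous_on_opnorm by auto
  then have min: "mat_opnorm X1 \<le> mat_opnorm Y" if "Y \<in> Z" for Y
    using that by (meson le_cases order_trans)
  have "Inf (mat_opnorm ` Z) = mat_opnorm X1"
    using X1(1) min by (intro cInf_eq_minimum) auto
  then have mu: "mu_hexa A = 1 / mat_opnorm X1"
    using True by (auto simp: mu_hexa_def Z_eq)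
  have pos: "mat_opnorm X1 > 0"
  proof (rule ccontr)
    assume "\<not> mat_opnorm X1 > 0"
    then have "X1 $ i $ j = 0" for i j
      using norm_entry_le_opnorm[of X1 i j] by (simp add: order_antisym_conv not_less)
        (metis norm_le_zero_iff order_trans)
    then show False
      using X1(1) by (simp add: Z_def hexa_poly_def)
  qed
  have "mu_hexa A < 1 \<longleftrightarrow> 1 < mat_opnorm X1"
    using pos by (simp add: mu)
  also have "\<dots> \<longleftrightarrow> (\<forall>X\<in>upper_contractions. hexa_poly (hexa_proj A) X \<noteq> 0)"
    using X1(1) min by (fastforce simp: upper_contractions_def Z_def)
  finally show ?thesis .
qed

section \<open>The open part of the \<open>\<mu>\<close>-hexablock\<close>

text \<open>The complement is the projection of the zero set of \<open>hexa_poly\<close> along a compact factor, hence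
  closed.\<close>

lemma open_zero_free: "open {q. \<forall>X\<in>upper_contractions. hexa_poly q X \<noteq> 0}"
proof -
  have "closed {(X, q). hexa_poly q X = 0}"
    unfolding hexa_poly_def case_prod_unfold by (intro closed_Collect_eq continuous_intros)
  from closed_compact_projection[OF compact_upper_contractions this]
  have "closed {q. \<exists>X. X \<in> upper_contractions \<and> hexa_poly q X = 0}"
    by simp
  then have "open (- {q. \<exists>X. X \<in> upper_contractions \<and> hexa_poly q X = 0})"
    by (rule open_Compl)
  moreover have "- {q. \<exists>X. X \<in> upper_contractions \<and> hexa_poly q X = 0}
      = {q. \<forall>X\<in>upper_contractions. hexa_poly q X \<noteq> 0}"
    by blast
  ultimately show ?thesis by simp
qed

text \<open>Where the first coordinate is nonzero, the missing entry of a preimage is determined by the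
  prescribed determinant.\<close>

lemma hexa_proj_surj:
  assumes "q $ 1 \<noteq> 0"
  shows "\<exists>A. q = hexa_proj A"
proof
  define A :: "complex^2^2" where
    "A = vector [vector [q $ 2, (q $ 2 * q $ 3 - q $ 4) / q $ 1], vector [q $ 1, q $ 3]]"
  show "q = hexa_proj A"
    using assms by (simp add: vec_eq_iff forall_4 hexa_proj_nth A_def det_2)
qed

lemma hexa_proj_inj:
  assumes "hexa_proj A = hexa_proj B" "A $ 2 $ 1 \<noteq> 0"
  shows "A = B"
proof -
  have "A $ 2 $ 1 = B $ 2 $ 1" "A $ 1 $ 1 = B $ 1 $ 1" "A $ 2 $ 2 = B $ 2 $ 2" "det A = det B"
    using arg_cong[OF assms(1), of "\<lambda>q. q $ 1"] arg_cong[OF assms(1), of "\<lambda>q. q $ 2"]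
      arg_cong[OF assms(1), of "\<lambda>q. q $ 3"] arg_cong[OF assms(1), of "\<lambda>q. q $ 4"]
    by (simp_all add: hexa_proj_nth)
  then show ?thesis
    using assms(2) by (auto simp: vec_eq_iff forall_2 det_2)
qed

lemma open_mu_hexablock_nonzero: "open (mu_hexablock \<inter> {q. q $ 1 \<noteq> 0})"
proof -
  have "mu_hexablock \<inter> {q. q $ 1 \<noteq> 0}
      = {q. \<forall>X\<in>upper_contractions. hexa_poly q X \<noteq> 0} \<inter> {q. q $ 1 \<noteq> 0}"
    using hexa_proj_surj by (fastforce simp: mu_hexablock_def mu_hexa_less_1_iff)
  moreover have "open {q :: complex^4. q $ 1 \<noteq> 0}"
    by (intro open_Collect_neq continuous_intros)
  ultimately show ?thesis
    using open_zero_free by auto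
qed

text \<open>For triangular \<open>A\<close> the polynomial factors as \<open>(1 - A $ 1 $ 1 * x) * (1 - A $ 2 $ 2 * z)\<close>; if a
  diagonal entry had modulus at least \<open>1\<close>, its reciprocal, padded by zeros, would be a contraction
  at which the polynomial vanishes.\<close>

lemma mu_hexablock_zero_subset_normed:
  assumes "q \<in> mu_hexablock" "q $ 1 = 0"
  shows "q \<in> normed_hexablock"
proof -
  obtain A where q: "q = hexa_proj A"
    and nz: "\<And>X. X \<in> upper_contractions \<Longrightarrow> hexa_poly (hexa_proj A) X \<noteq> 0"
    using assms(1) by (auto simp: mu_hexablock_def mu_hexa_less_1_iff)
  have A21: "A $ 2 $ 1 = 0"
    using assms(2) by (simp add: q hexa_proj_nth)
  have 1: "norm (A $ 1 $ 1) < 1"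
  proof (rule ccontr)
    define X :: "complex^2^2" where "X = vector [vector [1 / A $ 1 $ 1, 0], vector [0, 0]]"
    assume big: "\<not> norm (A $ 1 $ 1) < 1"
    then have "mat_opnorm X \<le> 1"
      by (intro opnorm_diagonal_le) (auto simp: X_def norm_divide divide_le_eq)
    then have "hexa_poly (hexa_proj A) X \<noteq> 0"
      by (intro nz) (simp add: upper_contractions_def upper_triangular2_def X_def)
    with big show False
      by (auto simp: hexa_poly_def X_def hexa_proj_nth split: if_splits)
  qed
  have 2: "norm (A $ 2 $ 2) < 1"
  proof (rule ccontr)
    define X :: "complex^2^2" where "X = vector [vector [0, 0], vector [0, 1 / A $ 2 $ 2]]"
    assume big: "\<not> norm (A $ 2 $ 2) < 1"
    then have "mat_opnorm X \<le> 1"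
      by (intro opnorm_diagonal_le) (auto simp: X_def norm_divide divide_le_eq)
    then have "hexa_poly (hexa_proj A) X \<noteq> 0"
      by (intro nz) (simp add: upper_contractions_def upper_triangular2_def X_def)
    with big show False
      by (auto simp: hexa_poly_def X_def hexa_proj_nth split: if_splits)
  qed
  define D :: "complex^2^2" where "D = vector [vector [A $ 1 $ 1, 0], vector [0, A $ 2 $ 2]]"
  have "mat_opnorm D \<le> max (norm (A $ 1 $ 1)) (norm (A $ 2 $ 2))"
    by (intro opnorm_diagonal_le) (auto simp: D_def)
  then have "mat_opnorm D < 1"
    using 1 2 by simp
  moreover have "q = hexa_proj D"
    using A21 by (simp add: q hexa_proj_def D_def det_2)
  ultimately show ?thesis
    by (auto simp: normed_hexablock_def)
qed

section \<open>Points outside the closed normed hexablock\<close>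

lemma compact_hexa_proj_ball: "compact (hexa_proj ` {A. mat_opnorm A \<le> 1})"
proof (rule compact_continuous_image[OF _ compact_opnorm_ball])
  have "continuous_on S (\<lambda>A. hexa_proj A $ i)" for S i
    using exhaust_4[of i]
    by (elim disjE; simp add: hexa_proj_nth det_2; intro continuous_intros)
  then have "continuous_on S (\<lambda>A. \<chi> i. hexa_proj A $ i)" for S
    by (rule continuous_on_vec_lambda)
  then show "continuous_on {A. mat_opnorm A \<le> 1} hexa_proj"
    by (simp only: vec_nth_inverse)
qed

text \<open>The matrix with rows \<open>(0, 2)\<close> and \<open>(1/4, 0)\<close>. At a contraction \<open>X\<close> its polynomial is
  \<open>1 - y / 4 - x * z / 2\<close> with \<open>x\<close>, \<open>y\<close>, \<open>z\<close> bounded by \<open>1\<close>, hence it is at least \<open>1/4\<close> in modulus;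
  yet the norm of the matrix is at least its entry \<open>2\<close>.\<close>

lemma mu_hexablock_point_outside_ball:
  obtains q where "q \<in> mu_hexablock" "q $ 1 \<noteq> 0" "q \<notin> hexa_proj ` {A. mat_opnorm A \<le> 1}"
proof
  define A :: "complex^2^2" where "A = vector [vector [0, 2], vector [1 / 4, 0]]"
  have "hexa_poly (hexa_proj A) X \<noteq> 0" if "X \<in> upper_contractions" for X
  proof
    have le: "norm (X $ i $ j) \<le> 1" for i j
      using that norm_entry_le_opnorm[of X i j] by (simp add: upper_contractions_def)
    assume "hexa_poly (hexa_proj A) X = 0"
    then have "1 = X $ 1 $ 2 / 4 + X $ 1 $ 1 * X $ 2 $ 2 / 2"
      by (simp add: hexa_poly_def hexa_proj_nth A_def det_2 algebra_simps)
    then have "1 = norm (X $ 1 $ 2 / 4 + X $ 1 $ 1 * X $ 2 $ 2 / 2)"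
      by (metis norm_one)
    also have "\<dots> \<le> norm (X $ 1 $ 2 / 4) + norm (X $ 1 $ 1 * X $ 2 $ 2 / 2)"
      by (rule norm_triangle_ineq)
    also have "\<dots> \<le> 1 / 4 + 1 * 1 / 2"
      unfolding norm_divide norm_mult
      by (intro add_mono divide_mono mult_mono le) auto
    finally show False by simp
  qed
  then show "hexa_proj A \<in> mu_hexablock"
    by (auto simp: mu_hexablock_def mu_hexa_less_1_iff)
  show "hexa_proj A $ 1 \<noteq> 0"
    by (simp add: hexa_proj_nth A_def)
  have "A $ 2 $ 1 \<noteq> 0" "norm (A $ 1 $ 2) = 2"
    by (simp_all add: A_def)
  then show "hexa_proj A \<notin> hexa_proj ` {A. mat_opnorm A \<le> 1}"
    using hexa_proj_inj[of A] norm_entry_le_opnorm[of A 1 2] by fastforce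
qed

theorem proposition4p14:
  "mu_hexablock - normed_hexablock = interior mu_hexablock - normed_hexablock \<and>
   (\<exists>U. open U \<and> U \<noteq> {} \<and> U \<subseteq> mu_hexablock - normed_hexablock)"
proof
  have "mu_hexablock - normed_hexablock \<subseteq> mu_hexablock \<inter> {q. q $ 1 \<noteq> 0}"
    using mu_hexablock_zero_subset_normed by blast
  also have "\<dots> \<subseteq> interior mu_hexablock"
    by (rule interior_maximal[OF Int_lower1 open_mu_hexablock_nonzero])
  finally show "mu_hexablock - normed_hexablock = interior mu_hexablock - normed_hexablock"
    using interior_subset by blast
next
  define U where
    "U = mu_hexablock \<inter> {q. q $ 1 \<noteq> 0} - hexa_proj ` {A. mat_opnorm A \<le> 1}"
  have "open U"
    unfolding U_def
    by (intro open_Diff open_mu_hexablock_nonzero compact_imp_closed compact_hexa_proj_ball)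
  moreover have "U \<noteq> {}"
    using mu_hexablock_point_outside_ball by (auto simp: U_def)
  moreover have "U \<subseteq> mu_hexablock - normed_hexablock"
    by (fastforce simp: U_def normed_hexablock_def)
  ultimately show "\<exists>U. open U \<and> U \<noteq> {} \<and> U \<subseteq> mu_hexablock - normed_hexablock"
    by blast
qed

end
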